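(* Let $\zeta$ be a Liouville number. Then for every positive integer $k$: \begin{align*} \lambda_{k,1}(\zeta)&=\infty,\\ \frac{1}{k}\leq \lambda_{k,j}(\zeta)&\leq \frac{1}{j-1}, \qquad 2\leq j\leq k+1,\\ \widehat{\lambda}_{k,1}(\zeta)&=\frac{1}{k},\\ \widehat{\lambda}_{k,j}(\zeta)&=0, \qquad 2\leq j\leq k+1. \end{align*}
   Context: A real number $\zeta$ is a Liouville number if it is irrational and its irrationality exponent is infinite, i.e. for every $\eta\in\mathbb{R}$ the inequality $|\zeta-y/x|\leq x^{-\eta}$ has infinitely many solutions $(x,y)\in\mathbb{N}\times\mathbb{Z}$. For $\underline{\zeta}=(\zeta_1,\ldots,\zeta_k)\in\mathbb{R}^k$ and $1\leq j\leq k+1$, $\lambda_{k,j}(\underline{\zeta})$ (resp. $\widehat{\lambda}_{k,j}(\underline{\zeta})$) is the supremum of all $\eta\in\mathbb{R}$ such that the system $|x|\leq X$, $\max_{1\leq i\leq k}|\zeta_i x-y_i|\leq X^{-\eta}$ has at least $j$ linearly independent solutions $(x,y_1,\ldots,y_k)\in\mathbb{Z}^{k+1}$ for arbitrarily large real $X$ (resp. for all sufficiently large real $X$). For a real number $\zeta$ one writes $\lambda_{k,j}(\zeta):=\lambda_{k,j}(\zeta,\zeta^2,\ldots,\zeta^k)$ and $\widehat{\lambda}_{k,j}(\zeta):=\widehat{\lambda}_{k,j}(\zeta,\zeta^2,\ldots,\zeta^k)$. Convention: $1/0=\infty$. *)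

theory Defs
  imports "HOL-Analysis.Analysis" "HOL-Library.Extended_Real"
begin

definition liouville :: "real \<Rightarrow> bool" where
  "liouville \<zeta> \<longleftrightarrow> \<zeta> \<notin> \<rat> \<and>
     (\<forall>\<eta>::real. infinite {(x::nat, y::int). x \<ge> 1 \<and>
        \<bar>\<zeta> - real_of_int y / real x\<bar> \<le> real x powr (- \<eta>)})"

text \<open>Integer vectors in Z^(k+1) are represented as functions nat => int; coordinate 0 is x,
  coordinate i (1 <= i <= k) is y_i. A family v 0, ..., v (j-1) is linearly independent
  (over the reals) if no nontrivial real combination vanishes on coordinates 0..k.\<close>
definition lin_indep_fam :: "nat \<Rightarrow> nat \<Rightarrow> (nat \<Rightarrow> nat \<Rightarrow> int) \<Rightarrow> bool" where
  "lin_indep_fam k j v \<longleftrightarrow>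
     (\<forall>c :: nat \<Rightarrow> real. (\<forall>i\<le>k. (\<Sum>l<j. c l * real_of_int (v l i)) = 0) \<longrightarrow> (\<forall>l<j. c l = 0))"

definition has_sols :: "nat \<Rightarrow> nat \<Rightarrow> (nat \<Rightarrow> real) \<Rightarrow> real \<Rightarrow> real \<Rightarrow> bool" where
  "has_sols k j \<zeta>s \<eta> X \<longleftrightarrow>
     (\<exists>v :: nat \<Rightarrow> nat \<Rightarrow> int. lin_indep_fam k j v \<and>
        (\<forall>l<j. \<bar>real_of_int (v l 0)\<bar> \<le> X \<and>
           (\<forall>i\<in>{1..k}. \<bar>\<zeta>s i * real_of_int (v l 0) - real_of_int (v l i)\<bar> \<le> X powr (- \<eta>))))"

definition lam :: "nat \<Rightarrow> nat \<Rightarrow> (nat \<Rightarrow> real) \<Rightarrow> ereal" where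
  "lam k j \<zeta>s = Sup (ereal ` {\<eta>. \<exists>\<^sub>F X in at_top. has_sols k j \<zeta>s \<eta> X})"

definition lam_hat :: "nat \<Rightarrow> nat \<Rightarrow> (nat \<Rightarrow> real) \<Rightarrow> ereal" where
  "lam_hat k j \<zeta>s = Sup (ereal ` {\<eta>. \<forall>\<^sub>F X in at_top. has_sols k j \<zeta>s \<eta> X})"

definition lam1 :: "nat \<Rightarrow> nat \<Rightarrow> real \<Rightarrow> ereal" where
  "lam1 k j \<zeta> = lam k j (\<lambda>i. \<zeta> ^ i)"

definition lam_hat1 :: "nat \<Rightarrow> nat \<Rightarrow> real \<Rightarrow> ereal" where
  "lam_hat1 k j \<zeta> = lam_hat k j (\<lambda>i. \<zeta> ^ i)"

end

theory Submission
  imports Defs "HOL-Real_Asymp.Real_Asymp" "HOL-Number_Theory.Cong"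
begin

text \<open>
  Let \<open>p / q\<close> be a reduced fraction extremely close to \<open>\<zeta>\<close>, so that for \<open>X\<close> up to any fixed power of
  \<open>q\<close> we may replace \<open>\<zeta> ^ i\<close> by \<open>(p / q) ^ i\<close>. The vector \<open>(q ^ k, q ^ (k - 1) * p, ..., p ^ k)\<close> is a
  nearly exact solution, which gives the value \<open>\<infinity>\<close>. If \<open>X\<close> is a large power of \<open>q\<close>, every solution is
  proportional to this vector, which gives \<open>0\<close> for the uniform exponents with \<open>j \<ge> 2\<close>. If \<open>X\<close> is
  slightly below \<open>q ^ k\<close>, a solution with all errors below \<open>1 / q\<close> has \<open>q ^ i\<close> dividing its first
  coordinate for \<open>i = 1, ..., k\<close> successively, so it vanishes; Dirichlet's theorem gives the matching
  lower bound \<open>1 / k\<close>. For \<open>X = q ^ k\<close> there are \<open>k + 1\<close> independent solutions with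
  errors of order \<open>1 / q\<close>, which replaces an appeal to Minkowski's second theorem. The upper
  bound \<open>1 / (j - 1)\<close> holds for arbitrary \<open>\<zeta>s\<close> by a pigeonhole argument.
\<close>

section \<open>Filters and suprema of sets of exponents\<close>

lemma frequently_filterlim:
  assumes "filterlim f F G" "\<exists>\<^sub>F x in G. P (f x)"
  shows "\<exists>\<^sub>F y in F. P y"
  using assms unfolding frequently_def filterlim_iff by blast

lemma filterlim_of_nat_powr_at_top:
  "s > 0 \<Longrightarrow> filterlim (\<lambda>n::nat. real n powr s) at_top sequentially"
  by real_asymp

text \<open>Density of the reals lets a lower bound for an exponent be tested at strictly smaller
  values only. The gap to \<open>c\<close> is what later absorbs constant factors.\<close>

lemma ereal_le_Sup_image:
  assumes "\<And>\<eta>. \<eta> < c \<Longrightarrow> \<eta> \<in> S"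
  shows "ereal c \<le> Sup (ereal ` S)"
proof (rule dense_le)
  fix x assume x: "x < ereal c"
  then obtain y where y: "x < ereal y" "y < c"
    using ereal_dense2[OF x] by auto
  then have "ereal y \<le> Sup (ereal ` S)" using assms by (intro Sup_upper) auto
  then show "x \<le> Sup (ereal ` S)" using y by simp
qed

lemma Sup_image_ereal_le:
  assumes "\<And>\<eta>. \<eta> > c \<Longrightarrow> \<eta> \<notin> S"
  shows "Sup (ereal ` S) \<le> ereal c"
  using assms by (intro Sup_least) (force simp: not_less[symmetric])

section \<open>Reduced rational approximations to a Liouville number and its powers\<close>

text \<open>For a fixed \<open>q\<close> the best numerator is the integer nearest to
  \<open>\<zeta> * q\<close>, at positive distance by irrationality; only finitely many
  \<open>q\<close> compete. This is what forces reduced denominators to be large.\<close>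

lemma irrational_away_from_bounded_denominators:
  fixes \<zeta> :: real
  assumes "\<zeta> \<notin> \<rat>"
  obtains \<delta> where "\<delta> > 0" "\<And>q p. \<lbrakk>1 \<le> q; q \<le> M\<rbrakk> \<Longrightarrow> \<delta> \<le> \<bar>\<zeta> - of_int p / of_nat q\<bar>"
proof -
  define d where "d q = \<bar>\<zeta> * of_nat q - of_int (round (\<zeta> * of_nat q))\<bar> / of_nat q" for q :: nat
  define \<delta> where "\<delta> = Min (insert 1 (d ` {1..M}))"
  have pos: "d q > 0" if "q \<ge> 1" for q
  proof -
    have "\<zeta> * of_nat q \<noteq> of_int (round (\<zeta> * of_nat q))"
    proof
      assume "\<zeta> * of_nat q = of_int (round (\<zeta> * of_nat q))"
      then have "\<zeta> = of_int (round (\<zeta> * of_nat q)) / of_nat q" using that by (simp add: field_simps)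
      then have "\<zeta> \<in> \<rat>" by (metis Rats_divide Rats_of_int Rats_of_nat)
      with assms show False by simp
    qed
    with that show ?thesis by (simp add: d_def)
  qed
  show thesis
  proof
    show "\<delta> > 0" unfolding \<delta>_def by (subst Min_gr_iff) (auto intro: pos)
    fix q :: nat and p :: int assume q: "1 \<le> q" "q \<le> M"
    have "\<delta> \<le> d q" unfolding \<delta>_def using q by (intro Min_le) auto
    also have "d q \<le> \<bar>\<zeta> * of_nat q - of_int p\<bar> / of_nat q"
      unfolding d_def by (intro divide_right_mono) (use round_diff_minimal[of "\<zeta> * of_nat q" p] in \<open>auto simp: abs_minus_commute\<close>)
    also have "\<dots> = \<bar>(\<zeta> * of_nat q - of_int p) / of_nat q\<bar>" by simp
    also have "(\<zeta> * of_nat q - of_int p) / of_nat q = \<zeta> - of_int p / of_nat q"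
      using q by (simp add: field_simps)
    finally show "\<delta> \<le> \<bar>\<zeta> - of_int p / of_nat q\<bar>" .
  qed
qed

text \<open>Reducing \<open>y / x\<close> could make its denominator small. With
  \<open>2 powr -\<eta> < \<delta>\<close> and \<open>x \<ge> 2\<close> the error is below
  \<open>\<delta>\<close>, so the reduced denominator \<open>q\<close> still exceeds
  \<open>M\<close>; and \<open>q \<le> x\<close> keeps the error bound valid for
  \<open>q\<close>.\<close>

lemma liouville_reduced_approximation:
  fixes N :: real
  assumes "liouville \<zeta>"
  shows "\<exists>\<^sub>F q in sequentially. \<exists>p. coprime p (int q) \<and> \<bar>\<zeta> - of_int p / of_nat q\<bar> \<le> of_nat q powr - N"
  unfolding frequently_sequentially
proof
  fix M :: nat
  obtain \<delta> where \<delta>: "\<delta> > 0" "\<And>q p. \<lbrakk>1 \<le> q; q \<le> M\<rbrakk> \<Longrightarrow> \<delta> \<le> \<bar>\<zeta> - of_int p / of_nat q\<bar>"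
    using irrational_away_from_bounded_denominators assms unfolding liouville_def by metis
  have "eventually (\<lambda>\<eta>::real. 2 powr -\<eta> < \<delta>) at_top"
  proof (rule order_tendstoD)
    show "((\<lambda>\<eta>::real. 2 powr -\<eta>) \<longlongrightarrow> 0) at_top" by real_asymp
  qed fact
  then have "eventually (\<lambda>\<eta>::real. 2 powr -\<eta> < \<delta> \<and> \<eta> \<ge> max N 0) at_top"
    by (intro eventually_conj eventually_ge_at_top)
  then obtain \<eta> where \<eta>: "2 powr -\<eta> < \<delta>" "\<eta> \<ge> N" "\<eta> \<ge> 0"
    by (auto dest: eventually_happens)
  define S where "S = {(x::nat, y::int). x \<ge> 1 \<and> \<bar>\<zeta> - of_int y / of_nat x\<bar> \<le> of_nat x powr - \<eta>}"
  have "infinite S" using assms unfolding liouville_def S_def by blast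
  \<comment> \<open>For \<open>x = 1\<close> the defining inequality only says that the error is at
    most 1. All such pairs lie in this finite box, so a pair outside it has
    \<open>x \<ge> 2\<close>.\<close>
  moreover have "finite ({1::nat} \<times> {\<lfloor>\<zeta>\<rfloor> - 2..\<lceil>\<zeta>\<rceil> + 2})" by simp
  ultimately obtain x y where xy: "(x, y) \<in> S" "(x, y) \<notin> {1::nat} \<times> {\<lfloor>\<zeta>\<rfloor> - 2..\<lceil>\<zeta>\<rceil> + 2}"
    by (metis finite_subset subrelI)
  have "x \<noteq> 1"
  proof
    assume "x = 1"
    with xy have "\<bar>\<zeta> - of_int y\<bar> \<le> 1" "y \<notin> {\<lfloor>\<zeta>\<rfloor> - 2..\<lceil>\<zeta>\<rceil> + 2}" by (auto simp: S_def)
    then show False by (simp; linarith)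
  qed
  with xy have x: "x \<ge> 2" and app: "\<bar>\<zeta> - of_int y / of_nat x\<bar> \<le> of_nat x powr - \<eta>" by (auto simp: S_def)
  define g where "g = gcd y (int x)"
  define p where "p = y div g"
  define q where "q = nat (int x div g)"
  have g: "g > 0" using x by (auto simp: g_def)
  have yg: "y = p * g" by (simp add: p_def g_def)
  have xg: "int x = int q * g" using x g by (simp add: q_def g_def pos_imp_zdiv_nonneg_iff)
  have q1: "q \<ge> 1" using xg x by (cases q) auto
  have "coprime p (int q)"
  proof -
    have "coprime (y div g) (int x div g)" unfolding g_def using x by (intro div_gcd_coprime) auto
    moreover have "int q = int x div g" using xg g by simp
    ultimately show ?thesis by (simp add: p_def)
  qed
  have quot: "of_int y / of_nat x = (of_int p / of_nat q :: real)"
  proof -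
    have "(of_nat x :: real) = of_nat q * of_int g" using xg by (metis of_int_mult of_int_of_nat_eq)
    then show ?thesis using g q1 by (simp add: yg)
  qed
  have "of_nat x powr - \<eta> \<le> (2::real) powr -\<eta>"
    using x \<eta> by (intro powr_mono2') auto
  with app \<eta> quot have "\<bar>\<zeta> - of_int p / of_nat q\<bar> < \<delta>" by simp
  then have "q > M" using \<delta>(2)[of q p] q1 by linarith
  have "q \<le> x" using xg g by (metis dvd_triv_left dvd_imp_le of_nat_dvd_iff int_dvd_int_iff x zero_less_numeral less_le_trans)
  have "of_nat x powr - \<eta> \<le> real q powr -\<eta>"
    using \<open>q \<le> x\<close> q1 \<eta> by (intro powr_mono2') auto
  also have "\<dots> \<le> real q powr -N" using q1 \<eta> by (intro powr_mono) auto
  finally have "\<bar>\<zeta> - of_int p / of_nat q\<bar> \<le> of_nat q powr - N" using app quot by simp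
  with \<open>q > M\<close> \<open>coprime p (int q)\<close> show "\<exists>n\<ge>M. \<exists>p. coprime p (int n) \<and> \<bar>\<zeta> - of_int p / of_nat n\<bar> \<le> of_nat n powr - N"
    using less_imp_le by blast
qed

lemma abs_power_diff_le:
  fixes a b :: real
  assumes "\<bar>a\<bar> \<le> M" "\<bar>b\<bar> \<le> M" "1 \<le> M"
  shows "\<bar>a ^ i - b ^ i\<bar> \<le> real i * M ^ i * \<bar>a - b\<bar>"
proof (induction i)
  case (Suc i)
  have "a ^ Suc i - b ^ Suc i = a * (a ^ i - b ^ i) + b ^ i * (a - b)" by (simp add: algebra_simps)
  also have "\<bar>\<dots>\<bar> \<le> \<bar>a\<bar> * \<bar>a ^ i - b ^ i\<bar> + \<bar>b\<bar> ^ i * \<bar>a - b\<bar>"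
    by (metis abs_mult abs_triangle_ineq power_abs)
  also have "\<dots> \<le> M * (real i * M ^ i * \<bar>a - b\<bar>) + M ^ Suc i * \<bar>a - b\<bar>"
  proof (intro add_mono mult_mono Suc)
    have "\<bar>b\<bar> ^ i \<le> M ^ i" using assms by (intro power_mono) auto
    also have "\<dots> \<le> M ^ Suc i" using assms by (intro power_increasing) auto
    finally show "\<bar>b\<bar> ^ i \<le> M ^ Suc i" .
  qed (use assms in auto)
  also have "\<dots> = real (Suc i) * M ^ Suc i * \<bar>a - b\<bar>" by (simp add: algebra_simps)
  finally show ?case .
qed auto

lemma liouville_power_approximation:
  fixes N :: real
  assumes "liouville \<zeta>"
  shows "\<exists>\<^sub>F q in sequentially. \<exists>p. coprime p (int q) \<and>
    (\<forall>i\<le>k. \<bar>\<zeta> ^ i - (of_int p / of_nat q) ^ i\<bar> \<le> of_nat q powr - N)"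
proof -
  define M where "M = \<bar>\<zeta>\<bar> + 1"
  define C where "C = real k * M ^ k"
  have "eventually (\<lambda>q. real q \<ge> max 1 C) sequentially" by real_asymp
  \<comment> \<open>The extra power of \<open>q\<close> pays for the constant \<open>C\<close> of
    the power estimate; the absolute value makes the error at most 1, so that both
    \<open>\<zeta>\<close> and \<open>p / q\<close> are bounded by \<open>M\<close>.\<close>
  moreover have "\<exists>\<^sub>F q in sequentially. \<exists>p. coprime p (int q) \<and>
      \<bar>\<zeta> - of_int p / of_nat q\<bar> \<le> of_nat q powr - (\<bar>N\<bar> + 1)"
    by (rule liouville_reduced_approximation) fact
  ultimately have "\<exists>\<^sub>F q in sequentially. real q \<ge> max 1 C \<and> (\<exists>p. coprime p (int q) \<and>
      \<bar>\<zeta> - of_int p / of_nat q\<bar> \<le> of_nat q powr - (\<bar>N\<bar> + 1))"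
    by (rule frequently_eventually_conj[rotated])
  then show ?thesis
  proof (rule frequently_elim1, elim conjE exE)
    fix q :: nat and p :: int
    assume q: "max 1 C \<le> real q" and "coprime p (int q)"
      and app: "\<bar>\<zeta> - of_int p / of_nat q\<bar> \<le> of_nat q powr - (\<bar>N\<bar> + 1)"
    define r :: real where "r = of_int p / of_nat q"
    have "of_nat q powr - (\<bar>N\<bar> + 1) \<le> real q powr 0" using q by (intro powr_mono) auto
    then have "\<bar>\<zeta> - r\<bar> \<le> 1" using app q by (simp add: r_def)
    then have r: "\<bar>r\<bar> \<le> M" by (simp add: M_def)
    have M: "\<bar>\<zeta>\<bar> \<le> M" "1 \<le> M" by (auto simp: M_def)
    have "\<bar>\<zeta> ^ i - r ^ i\<bar> \<le> of_nat q powr - N" if "i \<le> k" for i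
    proof -
      have "\<bar>\<zeta> ^ i - r ^ i\<bar> \<le> real i * M ^ i * \<bar>\<zeta> - r\<bar>"
        using M r by (intro abs_power_diff_le)
      also have "real i * M ^ i \<le> C" unfolding C_def
        using that M by (intro mult_mono power_increasing) auto
      also have "C \<le> real q" using q by simp
      also have "real q * \<bar>\<zeta> - r\<bar> \<le> real q powr 1 * real q powr - (\<bar>N\<bar> + 1)"
        using app by (simp add: r_def mult_left_mono)
      also have "\<dots> = real q powr - \<bar>N\<bar>" by (subst powr_add[symmetric]) simp
      also have "\<dots> \<le> real q powr - N" using q by (intro powr_mono) auto
      finally show ?thesis by (simp add: mult_right_mono)
    qed
    with \<open>coprime p (int q)\<close> show "\<exists>p. coprime p (int q) \<and>
      (\<forall>i\<le>k. \<bar>\<zeta> ^ i - (of_int p / of_nat q) ^ i\<bar> \<le> of_nat q powr - N)"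
      unfolding r_def by blast
  qed
qed

text \<open>Common frame for all claims about arbitrarily large \<open>X\<close>: they are tested at
  \<open>X = q powr s\<close> for good denominators \<open>q\<close>. Each application tunes
  \<open>s\<close> and the quality \<open>N\<close>, and collects in \<open>P\<close> what holds for
  large \<open>q\<close>.\<close>

lemma liouville_frequentlyI:
  fixes N s :: real
  assumes "liouville \<zeta>" "s > 0" "eventually P sequentially"
    and Q: "\<And>q p. \<lbrakk>q \<ge> 1; P q; coprime p (int q);
      \<And>i. i \<le> k \<Longrightarrow> \<bar>\<zeta> ^ i - (of_int p / of_nat q) ^ i\<bar> \<le> of_nat q powr - N\<rbrakk> \<Longrightarrow> Q (real q powr s)"
  shows "\<exists>\<^sub>F X in at_top. Q X"
proof (rule frequently_filterlim)
  show "filterlim (\<lambda>n. real n powr s) at_top sequentially"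
    using assms by (intro filterlim_of_nat_powr_at_top)
  have "eventually (\<lambda>q. P q \<and> q \<ge> 1) sequentially"
    using assms by (intro eventually_conj eventually_ge_at_top)
  from frequently_eventually_conj[OF liouville_power_approximation[OF assms(1), of k N] this]
  show "\<exists>\<^sub>F q in sequentially. Q (real q powr s)"
    by (rule frequently_elim1) (use Q in blast)
qed

section \<open>Linear independence and the number of solutions\<close>

lemma lin_indep_fam_mono:
  assumes "lin_indep_fam k j v" "j' \<le> j"
  shows "lin_indep_fam k j' v"
  unfolding lin_indep_fam_def
proof (intro allI impI)
  fix c :: "nat \<Rightarrow> real" and l
  assume c: "\<forall>i\<le>k. (\<Sum>l<j'. c l * of_int (v l i)) = 0" and l: "l < j'"
  define c' where "c' l = (if l < j' then c l else 0)" for l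
  have "(\<Sum>l<j. c' l * of_int (v l i)) = (\<Sum>l<j'. c l * of_int (v l i))" for i
    using assms(2) by (intro sum.mono_neutral_cong_right) (auto simp: c'_def)
  with c have "\<forall>i\<le>k. (\<Sum>l<j. c' l * of_int (v l i)) = 0" by simp
  with assms l have "c' l = 0" unfolding lin_indep_fam_def by auto
  with l show "c l = 0" by (simp add: c'_def)
qed

lemma has_sols_mono:
  assumes "has_sols k j \<zeta>s \<eta> X" "j' \<le> j"
  shows "has_sols k j' \<zeta>s \<eta> X"
  using assms unfolding has_sols_def by (meson lin_indep_fam_mono order_less_le_trans)

lemma lin_indep_fam_1_iff:
  "lin_indep_fam k 1 v \<longleftrightarrow> (\<exists>i\<le>k. v 0 i \<noteq> 0)"
proof
  assume "lin_indep_fam k 1 v"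
  from this[unfolded lin_indep_fam_def, rule_format, of "\<lambda>_. 1" 0]
  show "\<exists>i\<le>k. v 0 i \<noteq> 0" by auto
qed (auto simp: lin_indep_fam_def)

section \<open>The first ordinary exponent is infinite\<close>

lemma liouville_frequently_has_sols_1:
  assumes "liouville \<zeta>" "k \<ge> 1"
  shows "\<exists>\<^sub>F X in at_top. has_sols k 1 (\<lambda>i. \<zeta> ^ i) \<eta> X"
\<comment> \<open>With \<open>X = q ^ k\<close>, this \<open>N\<close> makes the error
  \<open>q ^ k * q powr -N\<close> equal to \<open>X powr - \<eta>\<close>.\<close>
proof (rule liouville_frequentlyI[where P = "\<lambda>_. True" and k = k and N = "k + k * \<eta>" and s = k])
  fix q :: nat and p :: int
  assume q: "q \<ge> 1" and approx: "\<And>i. i \<le> k \<Longrightarrow>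
    \<bar>\<zeta> ^ i - (of_int p / of_nat q) ^ i\<bar> \<le> of_nat q powr - (real k + real k * \<eta>)"
  define v :: "nat \<Rightarrow> nat \<Rightarrow> int" where "v = (\<lambda>l i. int q ^ (k - i) * p ^ i)"
  have v0: "of_int (v 0 0) = real q powr real k"
    using q by (simp add: v_def powr_realpow)
  have "\<bar>\<zeta> ^ i * of_int (v 0 0) - of_int (v 0 i)\<bar> \<le> (real q powr real k) powr - \<eta>" if "i \<le> k" for i
  proof -
    have "real q ^ k = real q ^ (k - i) * real q ^ i" using that by (simp flip: power_add)
    then have "\<zeta> ^ i * of_int (v 0 0) - of_int (v 0 i) = real q ^ k * (\<zeta> ^ i - (of_int p / of_nat q) ^ i)"
      using q by (simp add: v_def field_simps)
    also have "\<bar>\<dots>\<bar> = real q powr k * \<bar>\<zeta> ^ i - (of_int p / of_nat q) ^ i\<bar>"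
      using q by (simp add: abs_mult powr_realpow)
    also have "\<dots> \<le> real q powr k * real q powr - (real k + real k * \<eta>)"
      by (intro mult_left_mono approx that) auto
    also have "\<dots> = real q powr (k * -\<eta>)" by (subst powr_add[symmetric]) simp
    also have "\<dots> = (real q powr real k) powr - \<eta>" by (rule powr_powr[symmetric])
    finally show ?thesis .
  qed
  moreover have "lin_indep_fam k 1 v" unfolding lin_indep_fam_1_iff using q by (intro exI[of _ 0]) (simp add: v_def)
  moreover have "\<bar>real_of_int (v 0 0)\<bar> \<le> real q powr real k" by (simp add: v0)
  ultimately show "has_sols k 1 (\<lambda>i. \<zeta> ^ i) \<eta> (real q powr real k)"
    unfolding has_sols_def by auto
qed (use assms in auto)

section \<open>Lower bound for the ordinary exponents: \<open>k + 1\<close> independent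
  solutions\<close>

text \<open>The base-\<open>q\<close> digits of \<open>x\<close> are chosen one at a time: adding a multiple of \<open>q ^ k\<close> changes
  \<open>x * (p / q) ^ i\<close> by an integer for \<open>i \<le> k\<close>, and a suitable multiple brings
  \<open>x * (p / q) ^ (k + 1)\<close> within \<open>1 / q\<close> of an integer.\<close>

lemma exists_near_integer_multiple:
  fixes p q :: int
  assumes "coprime p q" "q \<ge> 1" "1 \<le> s" "s \<le> k"
  shows "\<exists>x y. 0 \<le> x \<and> x < q ^ k \<and> (\<forall>i<s. p ^ i * x = q ^ i * y i) \<and> p ^ s * x \<noteq> q ^ s * y s \<and>
    (\<forall>i\<in>{1..k}. \<bar>p ^ i * x - q ^ i * y i\<bar> \<le> q ^ (i - 1))"
  using assms(4)
proof (induction k rule: dec_induct)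
  case base
  \<comment> \<open>Take \<open>x = q ^ (s - 1) * a\<close> with \<open>a\<close> inverse to
    \<open>p ^ s\<close> modulo \<open>q\<close>. The defects vanish below \<open>s\<close>, and at
    \<open>s\<close> the defect is exactly \<open>q ^ (s - 1)\<close>, which is nonzero.\<close>
  have "coprime (p ^ s) q" using assms by simp
  then obtain a0 where a0: "[p ^ s * a0 = 1] (mod q)" using cong_solve_coprime_int by blast
  define a where "a = a0 mod q"
  have a: "0 \<le> a" "a < q" using assms by (auto simp: a_def)
  have "[p ^ s * a = 1] (mod q)" using a0 unfolding a_def by (simp add: cong_def mod_mult_right_eq)
  then obtain t where t: "p ^ s * a = 1 + q * t"
    by (metis cong_iff_lin cong_sym)
  obtain r where s: "s = Suc r" using assms by (cases s) auto
  define y where "y i = (if i = s then t else p ^ i * a * q ^ (r - i))" for i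
  have eq: "p ^ i * (q ^ r * a) = q ^ i * y i" if "i < s" for i
  proof -
    have "q ^ r = q ^ i * q ^ (r - i)" using that s by (simp flip: power_add)
    then show ?thesis using that by (simp add: y_def algebra_simps)
  qed
  have eqs: "p ^ s * (q ^ r * a) - q ^ s * y s = q ^ r"
  proof -
    have "p ^ s * (q ^ r * a) = q ^ r * (1 + q * t)" by (simp flip: t)
    then show ?thesis by (simp add: y_def s algebra_simps)
  qed
  show ?case
  proof (intro exI conjI ballI allI impI)
    show "0 \<le> q ^ r * a" using a assms by simp
    show "q ^ r * a < q ^ s" using a assms by (simp add: s)
    show "p ^ i * (q ^ r * a) = q ^ i * y i" if "i < s" for i by (rule eq[OF that])
    show "p ^ s * (q ^ r * a) \<noteq> q ^ s * y s" using eqs assms by auto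
    show "\<bar>p ^ i * (q ^ r * a) - q ^ i * y i\<bar> \<le> q ^ (i - 1)" if "i \<in> {1..s}" for i
      using eq[of i] eqs that assms by (cases "i = s") (auto simp: s)
  qed
next
  case (step k)
  then obtain x y where x: "0 \<le> x" "x < q ^ k" and eq: "\<And>i. i < s \<Longrightarrow> p ^ i * x = q ^ i * y i"
    and neq: "p ^ s * x \<noteq> q ^ s * y s"
    and err: "\<And>i. i \<in> {1..k} \<Longrightarrow> \<bar>p ^ i * x - q ^ i * y i\<bar> \<le> q ^ (i - 1)" by blast
  define u where "u = p ^ Suc k * x div q ^ k"
  define r where "r = p ^ Suc k * x mod q ^ k"
  have r: "p ^ Suc k * x = q ^ k * u + r" "0 \<le> r" "r < q ^ k"
    using assms by (auto simp: u_def r_def)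
  have "coprime (p ^ Suc k) q" using assms by simp
  then obtain a0 where a0: "[p ^ Suc k * a0 = 1] (mod q)" using cong_solve_coprime_int by blast
  \<comment> \<open>The new digit cancels the quotient \<open>u\<close> modulo \<open>q\<close>, so
    \<open>p ^ Suc k * x'\<close> leaves only the old remainder \<open>r < q ^ k\<close> modulo
    \<open>q ^ Suc k\<close>.\<close>
  define b where "b = (- u * a0) mod q"
  have b: "0 \<le> b" "b < q" using assms by (auto simp: b_def)
  have "[p ^ Suc k * b = p ^ Suc k * (- u * a0)] (mod q)"
    unfolding b_def by (simp add: cong_def mod_mult_right_eq)
  also have "p ^ Suc k * (- u * a0) = - u * (p ^ Suc k * a0)" by (simp add: algebra_simps)
  also have "[\<dots> = - u * 1] (mod q)" using a0 by (rule cong_scalar_left)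
  finally have "[p ^ Suc k * b = - u] (mod q)" by simp
  then obtain t where t: "p ^ Suc k * b + u = q * t"
    by (metis add_eq_0_iff2 cong_iff_dvd_diff diff_minus_eq_add dvdE)
  define x' where "x' = x + b * q ^ k"
  define y' where "y' i = (if i = Suc k then t else y i + b * q ^ (k - i) * p ^ i)" for i
  have same: "p ^ i * x' - q ^ i * y' i = p ^ i * x - q ^ i * y i" if "i \<le> k" for i
  proof -
    have "q ^ k = q ^ i * q ^ (k - i)" using that by (simp flip: power_add)
    then show ?thesis using that by (simp add: x'_def y'_def algebra_simps)
  qed
  have new: "p ^ Suc k * x' - q ^ Suc k * y' (Suc k) = r"
  proof -
    have "p ^ Suc k * x' = q ^ k * (p ^ Suc k * b + u) + r" using r(1) by (simp add: x'_def algebra_simps)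
    then show ?thesis unfolding t by (simp add: y'_def algebra_simps)
  qed
  show ?case
  proof (intro exI conjI ballI allI impI)
    show "0 \<le> x'" using x b assms by (simp add: x'_def)
    have "x' < q ^ k + b * q ^ k" using x by (simp add: x'_def)
    also have "\<dots> = (b + 1) * q ^ k" by (simp add: algebra_simps)
    also have "\<dots> \<le> q * q ^ k" using b assms by (intro mult_right_mono) auto
    finally show "x' < q ^ Suc k" by simp
    show "p ^ i * x' = q ^ i * y' i" if "i < s" for i using same[of i] eq[OF that] that step by simp
    show "p ^ s * x' \<noteq> q ^ s * y' s" using same[of s] neq step by auto
    show "\<bar>p ^ i * x' - q ^ i * y' i\<bar> \<le> q ^ (i - 1)" if "i \<in> {1..Suc k}" for i
      using same[of i] new r err[of i] that by (cases "i = Suc k") auto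
  qed
qed

text \<open>The defects \<open>p ^ i * x - q ^ i * y i\<close> are linear in the vector. Vector 0
  has none, and vector \<open>l\<close> has its first nonzero defect at index \<open>l\<close>, so
  the matrix of defects for \<open>l \<ge> 1\<close> is triangular with nonzero diagonal. Coordinate
  0 then settles the coefficient of vector 0.\<close>

lemma lin_indep_fam_triangular:
  fixes p q :: int and v :: "nat \<Rightarrow> nat \<Rightarrow> int"
  assumes "v 0 0 \<noteq> 0" and "\<And>i. i \<le> k \<Longrightarrow> p ^ i * v 0 0 = q ^ i * v 0 i"
    and "\<And>l i. \<lbrakk>1 \<le> l; l \<le> k; i < l\<rbrakk> \<Longrightarrow> p ^ i * v l 0 = q ^ i * v l i"
    and "\<And>l. \<lbrakk>1 \<le> l; l \<le> k\<rbrakk> \<Longrightarrow> p ^ l * v l 0 \<noteq> q ^ l * v l l"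
  shows "lin_indep_fam k (k + 1) v"
  unfolding lin_indep_fam_def
proof (intro allI impI)
  fix c :: "nat \<Rightarrow> real" and l
  assume c: "\<forall>i\<le>k. (\<Sum>l<k + 1. c l * of_int (v l i)) = 0" and l: "l < k + 1"
  define e where "e l i = real_of_int (p ^ i * v l 0 - q ^ i * v l i)" for l i
  have e: "(\<Sum>l<k + 1. c l * e l i) = 0" if "i \<le> k" for i
  proof -
    have "(\<Sum>l<k + 1. c l * e l i) = of_int p ^ i * (\<Sum>l<k + 1. c l * of_int (v l 0)) -
        of_int q ^ i * (\<Sum>l<k + 1. c l * of_int (v l i))"
      unfolding sum_distrib_left sum_subtractf[symmetric]
      by (intro sum.cong refl) (simp add: e_def algebra_simps)
    with c that show ?thesis by simp
  qed
  have pos: "c i = 0" if "1 \<le> i" "i \<le> k" for i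
    using that
  proof (induction i rule: less_induct)
    case (less i)
    have "c l * e l i = 0" if "l < k + 1" "l \<noteq> i" for l
    proof (cases "l = 0 \<or> i < l")
      case True
      then have "p ^ i * v l 0 = q ^ i * v l i" using assms(2)[of i] assms(3)[of l i] that less.prems by auto
      then have "e l i = 0" unfolding e_def of_int_eq_0_iff by simp
      then show ?thesis by simp
    next
      case False
      with less that show ?thesis by auto
    qed
    then have "(\<Sum>l<k + 1. c l * e l i) = (\<Sum>l\<in>{i}. c l * e l i)"
      using less.prems by (intro sum.mono_neutral_right) auto
    with e[of i] less.prems have "c i * e i i = 0" by simp
    moreover have "e i i \<noteq> 0" using assms(4)[of i] less.prems unfolding e_def of_int_eq_0_iff by auto
    ultimately show ?case by simp
  qed
  have "(\<Sum>l<k + 1. c l * of_int (v l 0)) = (\<Sum>l\<in>{0}. c l * of_int (v l 0))"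
    using pos by (intro sum.mono_neutral_right) auto
  with c assms(1) have "c 0 = 0" by auto
  with pos l show "c l = 0" by (cases "l = 0") auto
qed

text \<open>At \<open>X = q ^ k\<close> each error is at most \<open>2 / q\<close>: one
  \<open>1 / q\<close> from the digit construction for \<open>p / q\<close>, the other from
  replacing \<open>\<zeta>\<close> by \<open>p / q\<close> with \<open>N = k + 1\<close>. Since
  \<open>k * \<eta> < 1\<close>, this is below \<open>X powr - \<eta>\<close> for large
  \<open>q\<close>.\<close>

lemma liouville_frequently_has_sols:
  assumes "liouville \<zeta>" "k \<ge> 1" "j \<le> k + 1" "\<eta> < 1 / real k"
  shows "\<exists>\<^sub>F X in at_top. has_sols k j (\<lambda>i. \<zeta> ^ i) \<eta> X"
proof (rule liouville_frequentlyI[where P = "\<lambda>q. 2 * real q powr -1 \<le> real q powr -(k * \<eta>)"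
      and k = k and N = "real k + 1" and s = k])
  define t where "t = real k * \<eta>"
  have "t < 1" using assms by (simp add: t_def field_simps)
  then have "((\<lambda>q. 2 * real q powr (t - 1)) \<longlongrightarrow> 0) sequentially" by real_asymp
  then have "eventually (\<lambda>q. 2 * real q powr (t - 1) < 1) sequentially"
    by (rule order_tendstoD) simp
  then show "eventually (\<lambda>q. 2 * real q powr -1 \<le> real q powr -(k * \<eta>)) sequentially"
    using eventually_ge_at_top[of 1]
  proof eventually_elim
    case (elim q)
    have "2 * real q powr -1 = (2 * real q powr (t - 1)) * real q powr - t"
      unfolding mult.assoc powr_add[symmetric] by (simp del: powr_neg_one)
    also have "\<dots> \<le> 1 * real q powr - t" using elim by (intro mult_right_mono) auto
    finally show ?case by (simp add: t_def)
  qed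
next
  fix q :: nat and p :: int
  assume q: "q \<ge> 1" and large: "2 * real q powr -1 \<le> real q powr -(k * \<eta>)"
    and cop: "coprime p (int q)" and approx: "\<And>i. i \<le> k \<Longrightarrow>
    \<bar>\<zeta> ^ i - (of_int p / of_nat q) ^ i\<bar> \<le> of_nat q powr - (real k + 1)"
  have "\<forall>l. \<exists>w. 1 \<le> l \<and> l \<le> k \<longrightarrow> 0 \<le> w 0 \<and> w 0 < int q ^ k \<and> (\<forall>i<l. p ^ i * w 0 = int q ^ i * w i) \<and>
    p ^ l * w 0 \<noteq> int q ^ l * w l \<and> (\<forall>i\<in>{1..k}. \<bar>p ^ i * w 0 - int q ^ i * w i\<bar> \<le> int q ^ (i - 1))"
  proof
    fix l
    show "\<exists>w. 1 \<le> l \<and> l \<le> k \<longrightarrow> 0 \<le> w 0 \<and> w 0 < int q ^ k \<and> (\<forall>i<l. p ^ i * w 0 = int q ^ i * w i) \<and>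
      p ^ l * w 0 \<noteq> int q ^ l * w l \<and> (\<forall>i\<in>{1..k}. \<bar>p ^ i * w 0 - int q ^ i * w i\<bar> \<le> int q ^ (i - 1))"
    proof (cases "1 \<le> l \<and> l \<le> k")
      case True
      then obtain x y where "0 \<le> x \<and> x < int q ^ k \<and> (\<forall>i<l. p ^ i * x = int q ^ i * y i) \<and>
        p ^ l * x \<noteq> int q ^ l * y l \<and> (\<forall>i\<in>{1..k}. \<bar>p ^ i * x - int q ^ i * y i\<bar> \<le> int q ^ (i - 1))"
        using exists_near_integer_multiple[OF cop, of l k] q by auto
      with True show ?thesis by (intro exI[of _ "y(0 := x)"]) auto
    qed auto
  qed
  then obtain w where w: "\<And>l. \<lbrakk>1 \<le> l; l \<le> k\<rbrakk> \<Longrightarrow> 0 \<le> w l 0 \<and> w l 0 < int q ^ k \<and>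
      (\<forall>i<l. p ^ i * w l 0 = int q ^ i * w l i) \<and> p ^ l * w l 0 \<noteq> int q ^ l * w l l \<and>
      (\<forall>i\<in>{1..k}. \<bar>p ^ i * w l 0 - int q ^ i * w l i\<bar> \<le> int q ^ (i - 1))"
    by metis
  \<comment> \<open>The choice of \<open>w\<close> is constrained only at indices \<open>1\<close>
    to \<open>k\<close>; index 0 receives the exact multiple of the powers of
    \<open>p / q\<close>.\<close>
  define v where "v = w(0 := \<lambda>i. int q ^ (k - i) * p ^ i)"
  have v0: "p ^ i * v 0 0 = int q ^ i * v 0 i" if "i \<le> k" for i
  proof -
    have "int q ^ k = int q ^ i * int q ^ (k - i)" using that by (simp flip: power_add)
    then show ?thesis by (simp add: v_def)
  qed
  have "lin_indep_fam k (k + 1) v"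
  proof (rule lin_indep_fam_triangular[of v k p "int q"])
    show "v 0 0 \<noteq> 0" using q by (simp add: v_def)
  qed (use v0 w in \<open>auto simp: v_def\<close>)
  moreover have v_le: "\<bar>v l 0\<bar> \<le> int q ^ k" if "l < k + 1" for l
    using w[of l] that by (cases "l = 0") (auto simp: v_def)
  have v_le': "\<bar>real_of_int (v l 0)\<bar> \<le> real q powr k" if "l < k + 1" for l
  proof -
    have "real_of_int \<bar>v l 0\<bar> \<le> real_of_int (int q ^ k)" using v_le[OF that] by (simp only: of_int_le_iff)
    then show ?thesis using q by (simp add: powr_realpow)
  qed
  moreover have "\<bar>\<zeta> ^ i * of_int (v l 0) - of_int (v l i)\<bar> \<le> (real q powr k) powr - \<eta>"
    if l: "l < k + 1" and i: "i \<in> {1..k}" for l i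
  proof -
    define r :: real where "r = of_int p / of_nat q"
    have "\<bar>p ^ i * v l 0 - int q ^ i * v l i\<bar> \<le> int q ^ (i - 1)"
    proof (cases "l = 0")
      case True
      have "p ^ i * v 0 0 - int q ^ i * v 0 i = 0" using v0[of i] i by simp
      with True show ?thesis by simp
    next
      case False
      with w[of l] l i show ?thesis by (simp add: v_def)
    qed
    then have "real_of_int \<bar>p ^ i * v l 0 - int q ^ i * v l i\<bar> \<le> real_of_int (int q ^ (i - 1))"
      by (simp only: of_int_le_iff)
    then have "\<bar>of_int p ^ i * of_int (v l 0) - real q ^ i * of_int (v l i)\<bar> \<le> real q ^ (i - 1)" by simp
    moreover have "of_int p ^ i * of_int (v l 0) - real q ^ i * of_int (v l i) =
        real q ^ i * (r ^ i * of_int (v l 0) - of_int (v l i))"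
      using q by (simp add: r_def field_simps)
    moreover have "real q ^ i = real q * real q ^ (i - 1)" using i by (cases i) auto
    ultimately have "real q ^ (i - 1) * (real q * \<bar>r ^ i * of_int (v l 0) - of_int (v l i)\<bar>) \<le> real q ^ (i - 1) * 1"
      by (simp add: abs_mult mult_ac)
    then have "real q * \<bar>r ^ i * of_int (v l 0) - of_int (v l i)\<bar> \<le> 1"
      using q by (subst (asm) mult_le_cancel_left_pos) auto
    then have B: "\<bar>r ^ i * of_int (v l 0) - of_int (v l i)\<bar> \<le> real q powr -1"
      using q by (simp add: powr_minus field_simps)
    have "\<bar>\<zeta> ^ i - r ^ i\<bar> * \<bar>of_int (v l 0)\<bar> \<le> real q powr - (real k + 1) * real q powr k"
      using approx[of i] i v_le'[OF l] by (intro mult_mono) (auto simp: r_def)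
    also have "\<dots> = real q powr -1" by (simp flip: powr_add)
    finally have A: "\<bar>(\<zeta> ^ i - r ^ i) * of_int (v l 0)\<bar> \<le> real q powr -1" by (simp add: abs_mult)
    have "\<zeta> ^ i * of_int (v l 0) - of_int (v l i) =
        (\<zeta> ^ i - r ^ i) * of_int (v l 0) + (r ^ i * of_int (v l 0) - of_int (v l i))"
      by (simp add: algebra_simps)
    then have "\<bar>\<zeta> ^ i * of_int (v l 0) - of_int (v l i)\<bar> \<le> 2 * real q powr -1" using A B by linarith
    also note large
    also have "real q powr -(k * \<eta>) = (real q powr k) powr - \<eta>" by (simp add: powr_powr)
    finally show ?thesis .
  qed
  ultimately have "has_sols k (k + 1) (\<lambda>i. \<zeta> ^ i) \<eta> (real q powr k)"
    unfolding has_sols_def by (intro exI[of _ v]) auto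
  then show "has_sols k j (\<lambda>i. \<zeta> ^ i) \<eta> (real q powr k)"
    using assms(3) by (rule has_sols_mono)
qed (use assms in auto)

section \<open>The first uniform exponent\<close>

text \<open>Simultaneous Dirichlet approximation with \<open>N\<close> the integer part of
  \<open>X powr (1 / k)\<close> gives \<open>x \<le> N ^ k \<le> X\<close> and errors below
  \<open>1 / N\<close>. Rounding costs at most a factor 2, which the gap \<open>d\<close>
  absorbs.\<close>

lemma eventually_has_sols_1:
  assumes "k \<ge> 1" "\<eta> < 1 / real k"
  shows "\<forall>\<^sub>F X in at_top. has_sols k 1 \<zeta>s \<eta> X"
proof -
  define d where "d = 1 / real k - \<eta>"
  have "d > 0" using assms by (simp add: d_def)
  then have "((\<lambda>X::real. 2 * X powr - d) \<longlongrightarrow> 0) at_top" by real_asymp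
  then have "eventually (\<lambda>X::real. 2 * X powr - d < 1) at_top" by (rule order_tendstoD) simp
  then show ?thesis using eventually_ge_at_top[of 1]
  proof eventually_elim
    case (elim X)
    define N where "N = nat \<lfloor>X powr (1 / k)\<rfloor>"
    have X1: "X powr (1 / k) \<ge> 1" using elim assms by (intro ge_one_powr_ge_zero) auto
    then have N: "N > 0" "real N \<le> X powr (1 / k)" unfolding N_def by linarith+
    have "X powr (1 / k) < real N + 1" unfolding N_def by linarith
    then have N2: "X powr (1 / k) \<le> 2 * real N" using N(1) by simp
    obtain x y where x: "0 < x" "x \<le> int (N ^ k)"
      and y: "\<And>i. i < k \<Longrightarrow> \<bar>of_int x * \<zeta>s (Suc i) - of_int (y i)\<bar> < 1 / N"
      using Dirichlet_approx_simult[OF N(1), where \<theta> = "\<lambda>i. \<zeta>s (Suc i)" and n = k] by blast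
    define v where "v = (\<lambda>(l::nat) i. if i = 0 then x else y (i - 1))"
    have "real_of_int x \<le> real_of_int (int (N ^ k))" using x by (simp only: of_int_le_iff)
    also have "\<dots> = real N ^ k" by simp
    also have "\<dots> \<le> (X powr (1 / k)) ^ k" using N by (intro power_mono) auto
    also have "\<dots> = X" using elim assms X1 by (simp flip: powr_realpow add: powr_powr)
    finally have "\<bar>real_of_int x\<bar> \<le> X" using x by simp
    moreover have "\<bar>\<zeta>s i * of_int x - of_int (y (i - 1))\<bar> \<le> X powr - \<eta>" if "i \<in> {1..k}" for i
    proof -
      have "\<bar>\<zeta>s i * of_int x - of_int (y (i - 1))\<bar> \<le> 1 / N"
        using y[of "i - 1"] that less_imp_le by (fastforce simp: mult.commute)
      also have "\<dots> \<le> 2 / X powr (1 / k)" using frac_le[of 2 2 "X powr (1 / k)" "2 * real N"] N2 X1 by force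
      also have "\<dots> = 2 * X powr - d * X powr - \<eta>"
        unfolding mult.assoc powr_add[symmetric] by (simp add: d_def powr_minus_divide)
      also have "\<dots> \<le> 1 * X powr - \<eta>" using elim by (intro mult_right_mono) auto
      finally show ?thesis by simp
    qed
    moreover have "lin_indep_fam k 1 v" unfolding lin_indep_fam_1_iff
      using x by (intro exI[of _ 0]) (simp add: v_def)
    ultimately show ?case unfolding has_sols_def by (intro exI[of _ v]) (auto simp: v_def)
  qed
qed

lemma liouville_frequently_not_has_sols_1:
  assumes "liouville \<zeta>" "k \<ge> 1" "\<eta> > 1 / real k"
  shows "\<exists>\<^sub>F X in at_top. \<not> has_sols k 1 (\<lambda>i. \<zeta> ^ i) \<eta> X"
proof -
  have \<eta>: "\<eta> > 0" using assms by (meson less_trans of_nat_0_less_iff zero_less_divide_1_iff less_le_trans zero_less_one)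
  \<comment> \<open>The midpoint of \<open>1 / \<eta>\<close> and \<open>k\<close>: for
    \<open>X = q powr s\<close> with \<open>q\<close> large, \<open>s < k\<close> gives
    \<open>X < q ^ k\<close>, and \<open>s * \<eta> > 1\<close> gives
    \<open>X powr - \<eta> < 1 / q\<close>.\<close>
  define s where "s = (real k + 1 / \<eta>) / 2"
  have "1 / \<eta> < k" using assms \<eta> by (simp add: field_simps)
  then have s: "s > 0" "s < k" "s * \<eta> > 1" using \<eta> by (auto simp: s_def field_simps)
  show ?thesis
  proof (rule liouville_frequentlyI[where P = "\<lambda>q. real q powr -2 + real q powr -(s * \<eta>) < real q powr -1"
        and k = k and N = "s + 2" and s = s])
    define t where "t = s * \<eta>"
    have "t > 1" using s by (simp add: t_def)
    then have "((\<lambda>q. real q powr (1 - t)) \<longlongrightarrow> 0) sequentially" by real_asymp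
    moreover have "((\<lambda>q. real q powr -1) \<longlongrightarrow> 0) sequentially" by real_asymp
    ultimately have "((\<lambda>q. real q powr -1 + real q powr (1 - t)) \<longlongrightarrow> 0) sequentially"
      using tendsto_add_zero by blast
    then have "eventually (\<lambda>q. real q powr -1 + real q powr (1 - t) < 1) sequentially"
      by (rule order_tendstoD) simp
    then show "eventually (\<lambda>q. real q powr -2 + real q powr -(s * \<eta>) < real q powr -1) sequentially"
      using eventually_ge_at_top[of 1]
    proof eventually_elim
      case (elim q)
      have "real q powr -2 + real q powr -t = (real q powr -1 + real q powr (1 - t)) * real q powr -1"
        unfolding distrib_right powr_add[symmetric] by simp
      also have "\<dots> < 1 * real q powr -1" using elim by (intro mult_strict_right_mono) auto
      finally show ?case by (simp add: t_def)
    qed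
  next
    fix q :: nat and p :: int
    assume q: "q \<ge> 1" and large: "real q powr -2 + real q powr -(s * \<eta>) < real q powr -1"
      and cop: "coprime p (int q)" and approx: "\<And>i. i \<le> k \<Longrightarrow>
        \<bar>\<zeta> ^ i - (of_int p / of_nat q) ^ i\<bar> \<le> of_nat q powr - (s + 2)"
    define r :: real where "r = of_int p / of_nat q"
    show "\<not> has_sols k 1 (\<lambda>i. \<zeta> ^ i) \<eta> (real q powr s)"
    proof
      assume "has_sols k 1 (\<lambda>i. \<zeta> ^ i) \<eta> (real q powr s)"
      then obtain v where "lin_indep_fam k 1 v" and v0: "\<bar>real_of_int (v 0 0)\<bar> \<le> real q powr s"
        and err: "\<And>i. i \<in> {1..k} \<Longrightarrow> \<bar>\<zeta> ^ i * of_int (v 0 0) - of_int (v 0 i)\<bar> \<le> (real q powr s) powr - \<eta>"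
        unfolding has_sols_def by auto
      then obtain i0 where i0: "i0 \<le> k" "v 0 i0 \<noteq> 0" using lin_indep_fam_1_iff by blast
      define x where "x = v 0 0"
      have near: "\<bar>r ^ i * of_int x - of_int (v 0 i)\<bar> < 1 / real q" if "i \<in> {1..k}" for i
      proof -
        have "\<bar>\<zeta> ^ i - r ^ i\<bar> * \<bar>of_int x\<bar> \<le> real q powr - (s + 2) * real q powr s"
          using approx[of i] that v0 by (intro mult_mono) (auto simp: r_def x_def)
        also have "\<dots> = real q powr -2" by (simp flip: powr_add)
        finally have A: "\<bar>(\<zeta> ^ i - r ^ i) * of_int x\<bar> \<le> real q powr -2" by (simp add: abs_mult)
        have "r ^ i * of_int x - of_int (v 0 i) =
            (\<zeta> ^ i * of_int x - of_int (v 0 i)) - (\<zeta> ^ i - r ^ i) * of_int x" by (simp add: algebra_simps)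
        then have "\<bar>r ^ i * of_int x - of_int (v 0 i)\<bar> \<le> real q powr -2 + real q powr -(s * \<eta>)"
          using A err[OF that] by (simp add: powr_powr x_def)
        with large q show ?thesis by (simp add: powr_minus_divide)
      qed
      \<comment> \<open>If \<open>x = q ^ i * t\<close>, then \<open>r ^ Suc i * x\<close> is a
        fraction with denominator \<open>q\<close> lying less than \<open>1 / q\<close> from an
        integer, hence equal to it. Coprimality then gives \<open>q dvd t\<close>.\<close>
      have dvd: "int q ^ i dvd x" if "i \<le> k" for i
        using that
      proof (induction i)
        case (Suc i)
        then obtain t where t: "x = int q ^ i * t" by auto
        have "r ^ Suc i * of_int x = of_int (t * p ^ Suc i) / real q"
          using q by (simp add: r_def t field_simps)
        then have "\<bar>of_int (t * p ^ Suc i) / real q - of_int (v 0 (Suc i))\<bar> < 1 / real q"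
          using near[of "Suc i"] Suc.prems by simp
        moreover have "of_int (t * p ^ Suc i) / real q - of_int (v 0 (Suc i)) =
            of_int (t * p ^ Suc i - int q * v 0 (Suc i)) / real q" using q by (simp add: field_simps)
        ultimately have "\<bar>real_of_int (t * p ^ Suc i - int q * v 0 (Suc i))\<bar> < 1"
          using q by (simp add: field_simps del: of_int_diff of_int_mult of_int_power)
        then have "t * p ^ Suc i = int q * v 0 (Suc i)" by linarith
        then have "int q dvd t * p ^ Suc i" by simp
        moreover have "coprime (int q) (p ^ Suc i)" using cop by (simp add: coprime_commute)
        ultimately have "int q dvd t" by (metis coprime_dvd_mult_left_iff)
        then show ?case by (simp add: t mult_dvd_mono mult.commute)
      qed auto
      have "x = 0"
      proof (rule ccontr)
        assume "x \<noteq> 0"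
        then have "int q ^ k \<le> \<bar>x\<bar>" using dvd_imp_le_int[OF _ dvd[of k]] by simp
        then have "real_of_int (int q ^ k) \<le> real_of_int \<bar>x\<bar>" by (simp only: of_int_le_iff)
        then have "real q powr k \<le> real q powr s" using v0 q by (simp add: x_def powr_realpow)
        \<comment> \<open>For \<open>q = 1\<close> the inequality \<open>large\<close> would read
          \<open>2 < 1\<close>; a base above 1 is needed to compare exponents.\<close>
        moreover have "q \<noteq> 1" using large by auto
        ultimately show False using s q by (simp add: powr_le_cancel_iff)
      qed
      \<comment> \<open>Once \<open>x = 0\<close>, the errors are the remaining coordinates
        themselves: integers of absolute value below 1.\<close>
      with i0 have "i0 \<noteq> 0" by (auto simp: x_def intro!: Nat.gr0I)
      with near[of i0] i0 \<open>x = 0\<close> have "\<bar>real_of_int (v 0 i0)\<bar> < 1 / real q" by simp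
      also have "\<dots> \<le> 1" using q by simp
      finally show False using i0 by linarith
    qed
  qed (use assms s in auto)
qed

section \<open>The uniform exponents for \<open>j \<ge> 2\<close>\<close>

text \<open>The unit vectors have errors bounded independently of \<open>X\<close>, while
  \<open>X powr - \<eta>\<close> tends to infinity.\<close>

lemma eventually_has_sols_neg:
  assumes "\<eta> < 0" "j \<le> k + 1"
  shows "\<forall>\<^sub>F X in at_top. has_sols k j \<zeta>s \<eta> X"
proof -
  define B where "B = Max (insert 1 ((\<lambda>i. \<bar>\<zeta>s i\<bar>) ` {1..k}))"
  have B: "B \<ge> 1" "\<And>i. i \<in> {1..k} \<Longrightarrow> \<bar>\<zeta>s i\<bar> \<le> B"
    unfolding B_def by (intro Max_ge; simp)+
  have "filterlim (\<lambda>X::real. X powr - \<eta>) at_top at_top" using assms by real_asymp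
  then have "eventually (\<lambda>X::real. X powr - \<eta> \<ge> B) at_top" by (simp add: filterlim_at_top)
  then show ?thesis using eventually_ge_at_top[of 1]
  proof eventually_elim
    case (elim X)
    define v where "v l i = (if l = i then 1 else 0 :: int)" for l i :: nat
    have "lin_indep_fam k (k + 1) v" unfolding lin_indep_fam_def v_def
      by (auto simp: if_distrib sum.delta' cong: if_cong)
    moreover have "\<bar>\<zeta>s i * of_int (v l 0) - of_int (v l i)\<bar> \<le> X powr - \<eta>" if "i \<in> {1..k}" for l i
      using B(1) B(2)[OF that] elim that by (auto simp: v_def)
    ultimately have "has_sols k (k + 1) \<zeta>s \<eta> X"
      unfolding has_sols_def using elim by (intro exI[of _ v]) (auto simp: v_def)
    then show ?case using assms(2) by (rule has_sols_mono)
  qed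
qed

lemma not_lin_indep_fam_proportional:
  assumes "\<And>l i. \<lbrakk>l < 2; i \<le> k\<rbrakk> \<Longrightarrow> real_of_int (v l i) = r i * of_int (v l 0)"
  shows "\<not> lin_indep_fam k 2 v"
proof
  assume indep: "lin_indep_fam k 2 v"
  have two: "{..<2::nat} = {0, 1}" by auto
  from indep have *: "c 0 = 0 \<and> c 1 = 0"
    if "\<And>i. i \<le> k \<Longrightarrow> c 0 * of_int (v 0 i) + c 1 * of_int (v 1 i) = 0" for c :: "nat \<Rightarrow> real"
    using that unfolding lin_indep_fam_def two by auto
  have "of_int (v 1 0) * of_int (v 0 i) + - of_int (v 0 0) * of_int (v 1 i) = (0::real)" if "i \<le> k" for i
  proof -
    have "real_of_int (v 0 i) = r i * of_int (v 0 0)" "real_of_int (v 1 i) = r i * of_int (v 1 0)"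
      by (intro assms; use that in simp)+
    then show ?thesis by (simp only:) simp
  qed
  \<comment> \<open>The first coordinates, swapped and with one sign changed, are coefficients of a
    vanishing combination. Independence makes them zero, and proportionality then kills the whole
    vector \<open>v 0\<close>.\<close>
  then have v0: "v 0 0 = 0"
    using *[of "\<lambda>l. if l = 0 then of_int (v 1 0) else - of_int (v 0 0)"] by simp
  have "real_of_int (v 0 i) = 0" if "i \<le> k" for i
    using assms[of 0 i] that unfolding v0 by simp
  then show False
    using *[of "\<lambda>l. if l = 0 then 1 else 0"] by simp
qed

text \<open>The number \<open>r ^ i * x - y i\<close> has denominator dividing \<open>q ^ i\<close>,
  so it is zero once it is smaller than \<open>q powr - k\<close>. Hence any two solutions are
  proportional to the same vector.\<close>

lemma liouville_frequently_not_has_sols_2: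
  assumes "liouville \<zeta>" "\<eta> > 0"
  shows "\<exists>\<^sub>F X in at_top. \<not> has_sols k 2 (\<lambda>i. \<zeta> ^ i) \<eta> X"
proof -
  define s where "s = (real k + 1) / \<eta>"
  have s: "s > 0" "s * \<eta> = real k + 1" using assms by (auto simp: s_def)
  show ?thesis
  \<comment> \<open>Both \<open>X powr - \<eta>\<close> and the cost \<open>X * q powr -N\<close> of
    replacing \<open>\<zeta>\<close> equal \<open>q powr -(k + 1)\<close>; \<open>q \<ge> 3\<close>
    makes their sum less than \<open>q powr - k\<close>.\<close>
  proof (rule liouville_frequentlyI[where P = "\<lambda>q. q \<ge> 3" and k = k and N = "s + k + 1" and s = s])
    fix q :: nat and p :: int
    assume q: "q \<ge> 3" and approx: "\<And>i. i \<le> k \<Longrightarrow>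
        \<bar>\<zeta> ^ i - (of_int p / of_nat q) ^ i\<bar> \<le> of_nat q powr - (s + k + 1)"
    define r :: real where "r = of_int p / of_nat q"
    show "\<not> has_sols k 2 (\<lambda>i. \<zeta> ^ i) \<eta> (real q powr s)"
    proof
      assume "has_sols k 2 (\<lambda>i. \<zeta> ^ i) \<eta> (real q powr s)"
      then obtain v where indep: "lin_indep_fam k 2 v"
        and v0: "\<And>l. l < 2 \<Longrightarrow> \<bar>real_of_int (v l 0)\<bar> \<le> real q powr s"
        and err: "\<And>l i. \<lbrakk>l < 2; i \<in> {1..k}\<rbrakk> \<Longrightarrow>
          \<bar>\<zeta> ^ i * of_int (v l 0) - of_int (v l i)\<bar> \<le> (real q powr s) powr - \<eta>"
        unfolding has_sols_def by blast
      have "of_int (v l i) = r ^ i * of_int (v l 0)" if l: "l < 2" and i: "i \<le> k" for l i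
      proof (cases "i = 0")
        case False
        have "\<bar>\<zeta> ^ i - r ^ i\<bar> * \<bar>of_int (v l 0)\<bar> \<le> real q powr - (s + k + 1) * real q powr s"
          using approx[of i] i v0[OF l] by (intro mult_mono) (auto simp: r_def)
        also have "\<dots> = real q powr -(real k + 1)" unfolding powr_add[symmetric] by (simp add: algebra_simps)
        finally have A: "\<bar>(\<zeta> ^ i - r ^ i) * of_int (v l 0)\<bar> \<le> real q powr -(real k + 1)" by (simp add: abs_mult)
        have "r ^ i * of_int (v l 0) - of_int (v l i) =
            (\<zeta> ^ i * of_int (v l 0) - of_int (v l i)) - (\<zeta> ^ i - r ^ i) * of_int (v l 0)"
          by (simp add: algebra_simps)
        moreover have "\<bar>\<zeta> ^ i * of_int (v l 0) - of_int (v l i)\<bar> \<le> real q powr -(real k + 1)"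
          using err[OF l, of i] i False s(2) by (simp add: powr_powr)
        ultimately have "\<bar>r ^ i * of_int (v l 0) - of_int (v l i)\<bar> \<le> 2 * real q powr -(real k + 1)"
          using A by linarith
        also have "\<dots> < real q * real q powr -(real k + 1)" using q by (intro mult_strict_right_mono) auto
        also have "\<dots> = real q powr (1 + -(real k + 1))" using q by (subst powr_add) simp
        also have "\<dots> \<le> real q powr - i" using i q by (intro powr_mono) auto
        also have "\<dots> = 1 / real q ^ i" using q by (simp add: powr_minus_divide powr_realpow)
        finally have "real q ^ i * \<bar>r ^ i * of_int (v l 0) - of_int (v l i)\<bar> < 1"
          using q by (simp add: field_simps)
        moreover have "real_of_int (p ^ i * v l 0 - int q ^ i * v l i) =
            real q ^ i * (r ^ i * of_int (v l 0) - of_int (v l i))"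
          using q by (simp add: r_def field_simps)
        ultimately have "\<bar>real_of_int (p ^ i * v l 0 - int q ^ i * v l i)\<bar> < 1"
          by (simp add: abs_mult)
        then have "p ^ i * v l 0 - int q ^ i * v l i = 0" by linarith
        then have "real q ^ i * (r ^ i * of_int (v l 0) - of_int (v l i)) = 0"
          using \<open>real_of_int (p ^ i * v l 0 - int q ^ i * v l i) = _\<close> by simp
        then show ?thesis using q by simp
      qed simp
      then show False using not_lin_indep_fam_proportional indep by blast
    qed
  qed (use assms s in auto)
qed

section \<open>Upper bound for the ordinary exponents by counting\<close>

text \<open>Pigeonhole: the combinations of the solutions with coefficients in \<open>{0..X powr \<eta>}\<close> are distinct
  integer points whose distance from the line through \<open>\<zeta>s\<close> is bounded.\<close>

lemma has_sols_imp_le: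
  assumes sols: "has_sols k j \<zeta>s \<eta> X" and X: "X \<ge> 1" and \<eta>: "\<eta> \<ge> 0" and j: "j \<ge> 1"
  shows "X powr (\<eta> * j) \<le> 3 * j * (2 * j + 3) ^ k * X powr (1 + \<eta>)"
proof -
  from sols obtain v where indep: "lin_indep_fam k j v"
    and v0: "\<And>l. l < j \<Longrightarrow> \<bar>real_of_int (v l 0)\<bar> \<le> X"
    and err: "\<And>l i. \<lbrakk>l < j; i \<in> {1..k}\<rbrakk> \<Longrightarrow>
      \<bar>\<zeta>s i * of_int (v l 0) - of_int (v l i)\<bar> \<le> X powr - \<eta>"
    unfolding has_sols_def by blast
  define A where "A = \<lfloor>X powr \<eta>\<rfloor>"
  define m where "m = \<lfloor>j * X powr (1 + \<eta>)\<rfloor>"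
  define D where "D = {..<j} \<rightarrow>\<^sub>E {0..A}"
  define T where "T = {- m..m} \<times> ({1..k} \<rightarrow>\<^sub>E {- int (j + 1)..int (j + 1)})"
  define z where "z a i = (\<Sum>l<j. a l * v l i)" for a i
  \<comment> \<open>Given the first coordinate, the offsets from the integer parts determine the
    point, so \<open>f\<close> loses no information on coordinates \<open>0\<close> to
    \<open>k\<close>. Restriction makes the offsets a member of a finite function space.\<close>
  define f where "f a = (z a 0, restrict (\<lambda>i. z a i - \<lfloor>\<zeta>s i * of_int (z a 0)\<rfloor>) {1..k})" for a
  have A: "0 \<le> A" "of_int A \<le> X powr \<eta>" "X powr \<eta> \<le> of_int A + 1"
    unfolding A_def by (simp, linarith+)
  have "inj_on f D"
  proof (rule inj_onI)
    fix a b assume ab: "a \<in> D" "b \<in> D" "f a = f b"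
    have z0: "z a 0 = z b 0" using ab by (simp add: f_def)
    have "z a i = z b i" if "i \<le> k" for i
    proof (cases "i = 0")
      case False
      with that have "snd (f a) i = z a i - \<lfloor>\<zeta>s i * of_int (z a 0)\<rfloor>"
        "snd (f b) i = z b i - \<lfloor>\<zeta>s i * of_int (z b 0)\<rfloor>" by (auto simp: f_def)
      with ab z0 show ?thesis by simp
    qed (use z0 in simp)
    then have "(\<Sum>l<j. of_int (a l - b l) * real_of_int (v l i)) = 0" if "i \<le> k" for i
    proof -
      have "(\<Sum>l<j. of_int (a l - b l) * real_of_int (v l i)) = of_int (z a i - z b i)"
        by (simp add: z_def sum_subtractf algebra_simps)
      with \<open>\<And>i. i \<le> k \<Longrightarrow> z a i = z b i\<close> that show ?thesis by simp
    qed
    then have "\<forall>l<j. real_of_int (a l - b l) = 0"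
      using indep unfolding lin_indep_fam_def by (elim allE[of _ "\<lambda>l. real_of_int (a l - b l)"]) blast
    then show "a = b" using ab unfolding D_def by (intro PiE_ext) auto
  qed
  moreover have "f ` D \<subseteq> T"
  proof
    fix w assume "w \<in> f ` D"
    then obtain a where a: "a \<in> D" "w = f a" by auto
    have al: "0 \<le> a l" "real_of_int (a l) \<le> X powr \<eta>" if "l < j" for l
    proof -
      have "a l \<in> {0..A}" using a(1) that PiE_mem unfolding D_def by blast
      then have "0 \<le> a l" "real_of_int (a l) \<le> of_int A" by auto
      with A show "0 \<le> a l" "real_of_int (a l) \<le> X powr \<eta>" by linarith+
    qed
    have bound: "\<bar>\<Sum>l<j. of_int (a l) * u l\<bar> \<le> j * (X powr \<eta> * B)"
      if "\<And>l. l < j \<Longrightarrow> \<bar>u l\<bar> \<le> B" for u :: "nat \<Rightarrow> real" and B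
    proof -
      have "\<bar>\<Sum>l<j. of_int (a l) * u l\<bar> \<le> (\<Sum>l<j. \<bar>of_int (a l) * u l\<bar>)" by (rule sum_abs)
      also have "\<dots> \<le> (\<Sum>l<j. X powr \<eta> * B)"
        using al that by (intro sum_mono) (auto simp: abs_mult intro!: mult_mono)
      finally show ?thesis by simp
    qed
    have "\<bar>real_of_int (z a 0)\<bar> \<le> j * (X powr \<eta> * X)"
      using bound[of "\<lambda>l. of_int (v l 0)" X] v0 by (simp add: z_def)
    also have "\<dots> = j * X powr (1 + \<eta>)" using X by (simp add: powr_add mult.commute)
    finally have "\<bar>real_of_int (z a 0)\<bar> \<le> j * X powr (1 + \<eta>)" .
    then have "z a 0 \<in> {- m..m}" unfolding m_def by (simp; linarith)
    moreover have "z a i - \<lfloor>\<zeta>s i * of_int (z a 0)\<rfloor> \<in> {- int (j + 1)..int (j + 1)}" if "i \<in> {1..k}" for i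
    proof -
      have "\<zeta>s i * of_int (z a 0) - of_int (z a i) =
          (\<Sum>l<j. of_int (a l) * (\<zeta>s i * of_int (v l 0) - of_int (v l i)))"
        by (simp add: z_def sum_distrib_left sum_subtractf algebra_simps)
      \<comment> \<open>Coefficients up to \<open>X powr \<eta>\<close> exactly balance the errors,
        leaving the bound \<open>j\<close>; taking the floor adds at most 1, whence
        \<open>j + 1\<close> in \<open>T\<close> and \<open>2 * j + 3\<close> offsets per
        coordinate.\<close>
      also have "\<bar>\<dots>\<bar> \<le> j * (X powr \<eta> * X powr - \<eta>)"
        using err that by (intro bound) auto
      also have "\<dots> = j" using X by (simp flip: powr_add)
      finally have "\<bar>\<zeta>s i * of_int (z a 0) - of_int (z a i)\<bar> \<le> j" .
      then show ?thesis by (simp; linarith)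
    qed
    ultimately show "w \<in> T" using a by (auto simp: T_def f_def)
  qed
  moreover have "finite T" by (auto simp: T_def intro!: finite_PiE)
  ultimately have "card D \<le> card T" by (metis card_image card_mono)
  also have "card D = nat (A + 1) ^ j" by (simp add: D_def card_PiE)
  also have "card T = nat (2 * m + 1) * (2 * j + 3) ^ k"
    by (simp add: T_def card_PiE card_cartesian_product nat_add_distrib nat_mult_distrib add.commute)
  finally have "real (nat (A + 1) ^ j) \<le> real (nat (2 * m + 1) * (2 * j + 3) ^ k)"
    by (simp only: of_nat_le_iff)
  then have count: "real (nat (A + 1)) ^ j \<le> real (nat (2 * m + 1)) * (2 * j + 3) ^ k" by simp
  have m: "real (nat (2 * m + 1)) \<le> 3 * j * X powr (1 + \<eta>)"
  proof -
    have "1 * 1 \<le> real j * X powr (1 + \<eta>)"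
      using j X \<eta> by (intro mult_mono ge_one_powr_ge_zero) auto
    then show ?thesis unfolding m_def by linarith
  qed
  have "X powr (\<eta> * j) = (X powr \<eta>) ^ j" using X by (simp flip: powr_realpow add: powr_powr)
  also have "\<dots> \<le> real (nat (A + 1)) ^ j" using A by (intro power_mono) auto
  also note count
  also have "real (nat (2 * m + 1)) * (2 * j + 3) ^ k \<le> 3 * j * X powr (1 + \<eta>) * (2 * j + 3) ^ k"
    by (intro mult_right_mono m) auto
  also have "\<dots> = 3 * j * (2 * j + 3) ^ k * X powr (1 + \<eta>)" by simp
  finally show ?thesis .
qed

text \<open>The exponents \<open>\<eta> * j\<close> and \<open>1 + \<eta>\<close> in the counting
  bound differ by \<open>\<eta> * (j - 1) - 1 > 0\<close>, so the bound fails for large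
  \<open>X\<close>.\<close>

lemma eventually_not_has_sols:
  assumes "j \<ge> 2" "\<eta> > 1 / (real j - 1)"
  shows "\<forall>\<^sub>F X in at_top. \<not> has_sols k j \<zeta>s \<eta> X"
proof -
  define C where "C = 3 * real j * (2 * j + 3) ^ k"
  define d where "d = \<eta> * (real j - 1) - 1"
  have d: "d > 0" using assms by (simp add: d_def field_simps)
  have "1 / (real j - 1) > 0" using assms by simp
  with assms(2) have \<eta>: "\<eta> > 0" by linarith
  have "filterlim (\<lambda>X::real. X powr d) at_top at_top" using d by real_asymp
  then have "eventually (\<lambda>X::real. X powr d > C) at_top" by (simp add: filterlim_at_top_dense)
  then show ?thesis using eventually_ge_at_top[of 1]
  proof eventually_elim
    case (elim X)
    show ?case
    proof
      assume "has_sols k j \<zeta>s \<eta> X"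
      then have "X powr (\<eta> * j) \<le> C * X powr (1 + \<eta>)"
        using has_sols_imp_le[of k j \<zeta>s \<eta> X] elim \<eta> assms by (simp add: C_def)
      also have "X powr (\<eta> * j) = X powr d * X powr (1 + \<eta>)"
        unfolding powr_add[symmetric] by (simp add: d_def algebra_simps)
      finally show False using elim by simp
    qed
  qed
qed

theorem theorem6:
  fixes \<zeta> :: real and k :: nat
  assumes "liouville \<zeta>" and "k \<ge> 1"
  shows "lam1 k 1 \<zeta> = \<infinity>
    \<and> (\<forall>j\<in>{2..k+1}. ereal (1 / real k) \<le> lam1 k j \<zeta> \<and> lam1 k j \<zeta> \<le> ereal (1 / (real j - 1)))
    \<and> lam_hat1 k 1 \<zeta> = ereal (1 / real k)
    \<and> (\<forall>j\<in>{2..k+1}. lam_hat1 k j \<zeta> = 0)"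
proof (intro conjI ballI)
  have "ereal c \<le> lam1 k 1 \<zeta>" for c
    unfolding lam1_def lam_def
    using liouville_frequently_has_sols_1[OF assms] by (intro ereal_le_Sup_image) simp
  then show "lam1 k 1 \<zeta> = \<infinity>" by (simp add: ereal_top)
  show "lam_hat1 k 1 \<zeta> = ereal (1 / real k)"
    unfolding lam_hat1_def lam_hat_def
    using eventually_has_sols_1[OF assms(2)] liouville_frequently_not_has_sols_1[OF assms]
    by (intro antisym ereal_le_Sup_image Sup_image_ereal_le) (auto simp: frequently_def)
next
  fix j assume j: "j \<in> {2..k + 1}"
  show "ereal (1 / real k) \<le> lam1 k j \<zeta>"
    unfolding lam1_def lam_def
    using liouville_frequently_has_sols[OF assms] j by (intro ereal_le_Sup_image) simp
  show "lam1 k j \<zeta> \<le> ereal (1 / (real j - 1))"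
    unfolding lam1_def lam_def
    using eventually_not_has_sols j by (intro Sup_image_ereal_le) (simp add: frequently_def)
  have "\<not> (\<forall>\<^sub>F X in at_top. has_sols k j (\<lambda>i. \<zeta> ^ i) \<eta> X)" if "\<eta> > 0" for \<eta>
  proof
    assume "\<forall>\<^sub>F X in at_top. has_sols k j (\<lambda>i. \<zeta> ^ i) \<eta> X"
    then have "\<forall>\<^sub>F X in at_top. has_sols k 2 (\<lambda>i. \<zeta> ^ i) \<eta> X"
      by (rule eventually_mono) (use j has_sols_mono in auto)
    with liouville_frequently_not_has_sols_2[OF assms(1) that, of k] show False
      by (simp add: frequently_def)
  qed
  then have "lam_hat1 k j \<zeta> \<le> ereal 0"
    unfolding lam_hat1_def lam_hat_def by (intro Sup_image_ereal_le) simp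
  moreover have "ereal 0 \<le> lam_hat1 k j \<zeta>"
    unfolding lam_hat1_def lam_hat_def
    \<comment> \<open>Only negative exponents are realised by the unit vectors; their supremum still
      gives 0.\<close>
    using eventually_has_sols_neg j by (intro ereal_le_Sup_image) simp
  ultimately show "lam_hat1 k j \<zeta> = 0" by (simp add: zero_ereal_def)
qed

end
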